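(* Let $k\ge 6$ and $g=2d\ge 6$, and let $G$ be a $(k,g)$-graph of excess $4$. Let $A$ be the adjacency matrix of $G$, $E$ the excess matrix of $G$, $I$ the identity matrix and $J$ the all-ones matrix (all of size $n\times n$, where $n$ is the order of $G$). Then $$kJ=(A+kI)\bigl(H_{d-1}(A)+E\bigr).$$
   Context: Graphs are finite and simple. A $(k,g)$-graph is a $k$-regular graph of girth $g$. For even $g=2d$ the Moore bound is $M(k,g)=2\bigl(1+(k-1)+\dots+(k-1)^{d-1}\bigr)$, and the excess of a $(k,g)$-graph of order $n$ is $n-M(k,g)$. For $k\ge 6$ and $g=2d\ge 6$, a $(k,g)$-graph $G$ of excess $4$ is bipartite of diameter $d+1$ (known theorem of Biggs and Ito). The excess matrix $E$ of $G$ is the $n\times n$ matrix indexed by the vertices of $G$ with $E_{u,v}=1$ if the distance $d(u,v)$ in $G$ equals $d+1$, and $E_{u,v}=0$ otherwise. The polynomials $H_i(x)$ (Dickson polynomials of the second kind with parameter $k-1$) are defined by $H_0(x)=1$, $H_1(x)=x$, and $H_{i+1}(x)=xH_i(x)-(k-1)H_{i-1}(x)$ for $i\ge 1$. *)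

theory Defs
  imports
    "HOL-Analysis.Analysis"
    "HOL-Computational_Algebra.Polynomial"
    "Graph_Theory.Graph_Theory"
begin

text \<open>
  Finite simple graphs are rendered by the locale \<^locale>\<open>graph\<close>: finite, loop-free symmetric
  digraphs without parallel arcs, an edge being a pair of opposite arcs. Hence the degree
  of a vertex is its out-degree. Traversing an edge back and forth is a
  \<^const>\<open>pre_digraph.cycle\<close> of length 2, so cycles of the undirected graph are those of length
  at least 3.
\<close>

definition girth :: "('v, 'e) pre_digraph \<Rightarrow> enat" where
  "girth G = (INF p \<in> {p. pre_digraph.cycle G p \<and> 3 \<le> length p}. enat (length p))"

definition regular :: "nat \<Rightarrow> ('v, 'e) pre_digraph \<Rightarrow> bool" where
  "regular k G \<longleftrightarrow> (\<forall>v \<in> verts G. out_degree G v = k)"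

definition kg_graph :: "nat \<Rightarrow> nat \<Rightarrow> ('v, 'e) pre_digraph \<Rightarrow> bool" where
  "kg_graph k g G \<longleftrightarrow> graph G \<and> regular k G \<and> girth G = enat g"

text \<open>The Moore bound for even girth only.\<close>

definition even_moore_bound :: "nat \<Rightarrow> nat \<Rightarrow> int" where
  "even_moore_bound k g = 2 * (\<Sum>i < g div 2. (int k - 1) ^ i)"

definition excess :: "nat \<Rightarrow> nat \<Rightarrow> ('v, 'e) pre_digraph \<Rightarrow> int" where
  "excess k g G = int (card (verts G)) - even_moore_bound k g"

text \<open>Unit arc costs; the value is \<open>\<infinity>\<close> for vertices in different components.\<close>

definition graph_dist :: "('v, 'e) pre_digraph \<Rightarrow> 'v \<Rightarrow> 'v \<Rightarrow> ereal" where
  "graph_dist G u v = wf_digraph.\<mu> G (\<lambda>_. 1) u v"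

text \<open>
  Matrices are indexed by the vertices themselves, so they describe a graph whose vertex set is
  the whole (finite) type \<open>'v\<close>.
\<close>

definition adjacency_matrix :: "('v::finite, 'e) pre_digraph \<Rightarrow> real^'v^'v" where
  "adjacency_matrix G = (\<chi> u v. if u \<rightarrow>\<^bsub>G\<^esub> v then 1 else 0)"

definition excess_matrix :: "nat \<Rightarrow> ('v::finite, 'e) pre_digraph \<Rightarrow> real^'v^'v" where
  "excess_matrix d G = (\<chi> u v. if graph_dist G u v = ereal (real (d + 1)) then 1 else 0)"

definition all_ones_matrix :: "real^'v^'v" where
  "all_ones_matrix = (\<chi> u v. 1)"

text \<open>
  Powers must be taken with respect to \<open>**\<close>: on \<^typ>\<open>real^'v^'v\<close> both \<open>*\<close> and \<open>^\<close> act entrywise.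
\<close>

definition matrix_power :: "real^'v^'v \<Rightarrow> nat \<Rightarrow> real^('v::finite)^'v" where
  "matrix_power A i = (((**) A) ^^ i) (mat 1)"

definition matrix_poly :: "real poly \<Rightarrow> real^'v^'v \<Rightarrow> real^('v::finite)^'v" where
  "matrix_poly p A = (\<Sum>i\<le>degree p. coeff p i *\<^sub>R matrix_power A i)"

text \<open>Dickson polynomials of the second kind with parameter \<open>k - 1\<close>.\<close>

fun H :: "nat \<Rightarrow> nat \<Rightarrow> real poly" where
  "H k 0 = 1"
| "H k (Suc 0) = [:0, 1:]"
| "H k (Suc (Suc i)) = [:0, 1:] * H k (Suc i) - smult (real k - 1) (H k i)"

end

theory Submission
  imports Defs
begin

text \<open>
  Below distance \<open>d\<close> the graph looks like a tree, so each edge \<open>uv\<close> leaves a set \<open>X\<close> of exactly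
  four vertices at distance at least \<open>d\<close> from both \<open>u\<close> and \<open>v\<close>.
  Suppose that \<open>x\<close> in \<open>X\<close> has distance \<open>d\<close> from both, with \<open>p\<close> neighbours nearer to \<open>u\<close>, \<open>q\<close> nearer to
  \<open>v\<close> and \<open>r = k - p - q\<close> in \<open>X\<close>. Each of the \<open>p\<close> neighbours has at least \<open>q\<close> neighbours in \<open>X\<close> and
  each of the \<open>q\<close> neighbours at least \<open>p\<close>; as there are no triangles or quadrangles, these are distinct
  apart from \<open>x\<close>, so \<open>1 + r + p (q - 1) + q (p - 1) \<le> 4\<close>, which forces \<open>k \<le> 5\<close>.
  Hence distances from any vertex to the ends of an edge differ, and all distances are at most
  \<open>d + 1\<close> (Biggs and Ito).

  Consequently the entry of \<open>H\<^bsub>d-1\<^esub>(A) + E\<close> at \<open>(u, x)\<close> is 1 if the distance of \<open>u\<close> and \<open>x\<close> has the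
  parity of \<open>d - 1\<close>, and 0 otherwise. Stepping to a neighbour flips this parity, so
  multiplication by \<open>A + k I\<close> gives \<open>k\<close> everywhere.
\<close>

section \<open>Short non-backtracking walks\<close>

definition nonbacktracking :: "('v \<Rightarrow> 'v \<Rightarrow> bool) \<Rightarrow> 'v list \<Rightarrow> bool" where
  "nonbacktracking adj xs \<longleftrightarrow>
    successively adj xs \<and> (\<forall>j. j + 2 < length xs \<longrightarrow> xs ! j \<noteq> xs ! (j + 2))"

lemma nonbacktracking_Cons_Cons:
  "nonbacktracking adj (x # y # zs) \<longleftrightarrow>
    adj x y \<and> (zs \<noteq> [] \<longrightarrow> x \<noteq> hd zs) \<and> nonbacktracking adj (y # zs)"
proof -
  have "(\<forall>j. j + 2 < length (x # y # zs) \<longrightarrow> (x # y # zs) ! j \<noteq> (x # y # zs) ! (j + 2)) \<longleftrightarrow>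
    (zs \<noteq> [] \<longrightarrow> x \<noteq> hd zs) \<and>
    (\<forall>j. j + 2 < length (y # zs) \<longrightarrow> (y # zs) ! j \<noteq> (y # zs) ! (j + 2))" (is "?L \<longleftrightarrow> ?R")
  proof -
    have *: "(\<forall>j. P j) \<longleftrightarrow> P 0 \<and> (\<forall>j. P (Suc j))" for P :: "nat \<Rightarrow> bool"
      by (metis not0_implies_Suc)
    show ?thesis by (subst *) (auto simp: hd_conv_nth)
  qed
  then show ?thesis by (auto simp: nonbacktracking_def)
qed

lemma nonbacktracking_rev:
  assumes "symp adj" "nonbacktracking adj xs"
  shows "nonbacktracking adj (rev xs)"
proof -
  have "successively adj (rev xs)"
    using assms by (simp add: nonbacktracking_def) (metis (mono_tags, lifting) successively_mono sympD)
  moreover have "rev xs ! j \<noteq> rev xs ! (j + 2)" if "j + 2 < length xs" for j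
  proof -
    have "length xs - Suc (j + 2) + 2 = length xs - Suc j" using that by simp
    moreover have "xs ! (length xs - Suc (j + 2)) \<noteq> xs ! (length xs - Suc (j + 2) + 2)"
      using assms(2) that by (simp add: nonbacktracking_def)
    ultimately show ?thesis using that by (simp add: rev_nth)
  qed
  ultimately show ?thesis by (simp add: nonbacktracking_def)
qed

text \<open>Only distances up to \<open>d\<close> are described by the axioms; \<open>dst\<close> may be truncated above.\<close>

locale girth_distance =
  fixes adj :: "'v::finite \<Rightarrow> 'v \<Rightarrow> bool" and dst :: "'v \<Rightarrow> 'v \<Rightarrow> nat" and d :: nat
  assumes adj_sym: "adj u v \<Longrightarrow> adj v u"
    and dst_sym: "dst u x = dst x u"
    and dst_eq_0: "dst u x = 0 \<longleftrightarrow> u = x"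
    and dst_adj: "adj u v \<Longrightarrow> dst u x \<le> Suc (dst v x)"
    and dst_descent: "0 < dst u x \<Longrightarrow> dst u x \<le> d \<Longrightarrow> \<exists>v. adj u v \<and> dst u x = Suc (dst v x)"
    and short_distinct: "nonbacktracking adj xs \<Longrightarrow> length xs \<le> 2 * d \<Longrightarrow> distinct xs"
begin

lemma dst_self [simp]: "dst u u = 0"
  by (simp add: dst_eq_0)

text \<open>A geodesic from \<open>u\<close> to \<open>x\<close> is prepended vertex by vertex. Each
  new vertex is nearer to \<open>x\<close> than the two that follow it (for \<open>hd ws\<close> by
  the last hypothesis), so the walk never turns back.\<close>

lemma extend_to:
  assumes "nonbacktracking adj (u # ws)" "dst u x = i" "i \<le> d"
    and "ws \<noteq> [] \<Longrightarrow> i \<le> dst (hd ws) x"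
  shows "\<exists>qs. nonbacktracking adj (qs @ u # ws) \<and> length qs = i \<and> hd (qs @ u # ws) = x"
  using assms
proof (induction i arbitrary: u ws)
  case 0
  then show ?case by (intro exI[of _ "[]"]) (auto simp: dst_eq_0)
next
  case (Suc i)
  obtain w where w: "adj u w" "dst w x = i" using dst_descent[of u x] Suc.prems by auto
  have "nonbacktracking adj (w # u # ws)"
    using Suc.prems w adj_sym by (auto simp: nonbacktracking_Cons_Cons)
  with Suc.IH[of w "u # ws"] w Suc.prems
  obtain qs where "nonbacktracking adj (qs @ w # u # ws)" "length qs = i" "hd (qs @ w # u # ws) = x"
    by auto
  then show ?case by (intro exI[of _ "qs @ [w]"]) (auto simp: hd_append)
qed

lemma not_closed:
  assumes "nonbacktracking adj xs" "length xs \<le> 2 * d" "2 \<le> length xs"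
  shows "hd xs \<noteq> last xs"
proof (cases xs)
  case (Cons a ys)
  then show ?thesis using assms short_distinct[of xs] by (auto simp: last_in_set)
qed (use assms in auto)

lemma symp_adj: "symp adj"
  using adj_sym by (auto intro: sympI)

text \<open>Two geodesics meeting at \<open>x\<close>, joined at \<open>u\<close>, form a short closed walk.\<close>

lemma closer_unique:
  assumes "adj u v" "adj u v'" "dst u x = Suc i" "dst v x = i" "dst v' x = i" "Suc i < d"
  shows "v = v'"
proof (rule ccontr)
  assume ne: "v \<noteq> v'"
  have "nonbacktracking adj [v, u]"
    using assms adj_sym by (auto simp: nonbacktracking_def)
  from extend_to[OF this, of x i] assms
  obtain qs where qs: "nonbacktracking adj (qs @ [v, u])" "length qs = i" "hd (qs @ [v, u]) = x"
    by auto
  have "nonbacktracking adj (u # v # rev qs)"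
    using nonbacktracking_rev[OF symp_adj qs(1)] by simp
  then have "nonbacktracking adj (v' # u # v # rev qs)"
    using ne assms adj_sym by (auto simp: nonbacktracking_Cons_Cons)
  from extend_to[OF this, of x i] assms
  obtain rs where rs: "nonbacktracking adj (rs @ v' # u # v # rev qs)" "length rs = i"
    "hd (rs @ v' # u # v # rev qs) = x" by auto
  have "last (v # rev qs) = x" using qs(3) by (cases qs) auto
  then have "last (rs @ v' # u # v # rev qs) = x" by simp
  \<comment> \<open>The closed walk lists \<open>2 * i + 3\<close> vertices, which is less than
    \<open>2 * d\<close> because \<open>Suc i < d\<close>.\<close>
  with not_closed[OF rs(1)] rs qs assms show False by simp
qed

text \<open>Otherwise geodesics from both ends to \<open>x\<close>, joined by the edge, would form a
  closed non-backtracking walk with \<open>2 * dst u x + 1\<close> edges, too short for the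
  girth.\<close>

lemma dst_adj_neq:
  assumes "adj u v" "dst u x < d"
  shows "dst v x \<noteq> dst u x"
proof
  assume eq: "dst v x = dst u x"
  define i where "i = dst u x"
  have "nonbacktracking adj [u, v]"
    using assms by (auto simp: nonbacktracking_def)
  from extend_to[OF this, of x i] assms eq
  obtain qs where qs: "nonbacktracking adj (qs @ [u, v])" "length qs = i" "hd (qs @ [u, v]) = x"
    by (auto simp: i_def)
  have "nonbacktracking adj (v # u # rev qs)"
    using nonbacktracking_rev[OF symp_adj qs(1)] by simp
  from extend_to[OF this, of x i] assms eq
  obtain rs where rs: "nonbacktracking adj (rs @ v # u # rev qs)" "length rs = i"
    "hd (rs @ v # u # rev qs) = x" by (auto simp: i_def)
  have "last (u # rev qs) = x" using qs(3) by (cases qs) auto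
  then have "last (rs @ v # u # rev qs) = x" by simp
  with not_closed[OF rs(1)] rs qs assms show False by (simp add: i_def)
qed

lemma dst_adj': "adj u v \<Longrightarrow> dst x u \<le> Suc (dst x v)"
  using dst_adj[of u v x] by (simp add: dst_sym)

lemma closer_unique':
  "\<lbrakk>adj u v; adj u v'; dst x u = Suc i; dst x v = i; dst x v' = i; Suc i < d\<rbrakk> \<Longrightarrow> v = v'"
  using closer_unique[of u v v' x i] by (simp add: dst_sym)

lemma dst_adj_neq': "adj u v \<Longrightarrow> dst x u < d \<Longrightarrow> dst x v \<noteq> dst x u"
  using dst_adj_neq[of u v x] by (simp add: dst_sym)

lemma dst_descent':
  "0 < dst x u \<Longrightarrow> dst x u \<le> d \<Longrightarrow> \<exists>v. adj u v \<and> dst x u = Suc (dst x v)"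
  using dst_descent[of u x] by (simp add: dst_sym)

lemma dst_of_adj: "adj u v \<Longrightarrow> 0 < d \<Longrightarrow> dst u v = 1"
  using dst_adj'[of v u u] dst_adj_neq'[of u v u] by (simp add: adj_sym)

end

section \<open>Excess four\<close>

locale excess_four = girth_distance adj dst d
  for adj :: "'v::finite \<Rightarrow> 'v \<Rightarrow> bool" and dst d +
  fixes k :: nat
  assumes degree: "card {v. adj u v} = k"
    and order: "CARD('v) = 2 * (\<Sum>i<d. (k - 1) ^ i) + 4"
    and k_ge: "6 \<le> k" and d_ge: "3 \<le> d"
begin

section \<open>The two trees hanging from an edge\<close>

definition layer :: "'v \<Rightarrow> 'v \<Rightarrow> nat \<Rightarrow> 'v set" where
  "layer u v i = {x. dst u x = i \<and> dst v x = Suc i}"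

text \<open>The set \<open>X\<close> of the outline: what the two trees, cut off before level
  \<open>d\<close>, do not reach.\<close>

definition far :: "'v \<Rightarrow> 'v \<Rightarrow> 'v set" where
  "far u v = {x. d \<le> dst u x \<and> d \<le> dst v x}"

definition closer :: "'v \<Rightarrow> 'v \<Rightarrow> 'v set" where
  "closer u x = {a. adj x a \<and> Suc (dst u a) = dst u x}"

lemma card_closer:
  assumes "0 < dst u x" "dst u x < d"
  shows "card (closer u x) = 1"
proof -
  obtain a where a: "adj x a" "dst u x = Suc (dst u a)"
    using dst_descent'[of u x] assms by auto
  have "closer u x = {a}"
    using a closer_unique'[of x a _ u "dst u a"] assms by (auto simp: closer_def)
  then show ?thesis by simp
qed

lemma card_farther:
  assumes "0 < dst u x" "dst u x < d"
  shows "card {a. adj x a \<and> dst u a = Suc (dst u x)} = k - 1"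
proof -
  have split: "{a. adj x a} = closer u x \<union> {a. adj x a \<and> dst u a = Suc (dst u x)}"
  proof -
    have "Suc (dst u a) = dst u x \<or> dst u a = Suc (dst u x)" if "adj x a" for a
      using dst_adj'[OF that, of u] dst_adj'[OF adj_sym[OF that], of u]
        dst_adj_neq'[OF that, of u] assms by linarith
    then show ?thesis by (auto simp: closer_def)
  qed
  have "card {a. adj x a} = card (closer u x) + card {a. adj x a \<and> dst u a = Suc (dst u x)}"
    by (subst split, rule card_Un_disjoint) (auto simp: closer_def)
  then show ?thesis using card_closer[OF assms] degree[of x] by simp
qed

text \<open>The distance from \<open>v\<close> cannot fall by more than one in a single step, and
  the edge \<open>uv\<close> keeps it from falling by less.\<close>

lemma layer_closer:
  assumes uv: "adj u v" and y: "y \<in> layer u v (Suc i)" and i: "Suc i < d"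
    and a: "a \<in> closer u y"
  shows "a \<in> layer u v i"
proof -
  have "dst u a = i" "adj y a" using a y by (auto simp: layer_def closer_def)
  then have "dst v a \<le> Suc i" using dst_adj[of v u a] uv adj_sym by auto
  moreover have "Suc (Suc i) \<le> Suc (dst v a)"
    using dst_adj'[of y a v] \<open>adj y a\<close> y by (auto simp: layer_def)
  ultimately show ?thesis using \<open>dst u a = i\<close> by (auto simp: layer_def)
qed

lemma layer_farther:
  assumes uv: "adj u v" and x: "x \<in> layer u v i" and a: "adj x a" "dst v a = Suc (dst v x)"
  shows "a \<in> layer u v (Suc i)"
  using dst_adj'[OF adj_sym[OF a(1)], of u] dst_adj[OF adj_sym[OF uv], of a] x a(2)
  by (simp add: layer_def)

text \<open>Each vertex has \<open>k - 1\<close> children, and uniqueness of the nearer neighbour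
  below distance \<open>d\<close> gives each child a single parent.\<close>

lemma card_layer:
  assumes uv: "adj u v" and "i < d"
  shows "card (layer u v i) = (k - 1) ^ i"
  using \<open>i < d\<close>
proof (induction i)
  case 0
  have "dst v u = 1" using dst_of_adj[OF adj_sym[OF uv]] d_ge by simp
  then have "layer u v 0 = {u}" by (auto simp: layer_def dst_eq_0)
  then show ?case by simp
next
  case (Suc i)
  \<comment> \<open>Children are measured from \<open>v\<close>, not \<open>u\<close>, so that the
    root \<open>u\<close> also has exactly \<open>k - 1\<close> of them, \<open>v\<close> being
    excluded.\<close>
  define S where "S x = {a. adj x a \<and> dst v a = Suc (dst v x)}" for x
  have "layer u v (Suc i) = (\<Union>x\<in>layer u v i. S x)"
  proof (intro equalityI subsetI)
    fix y assume y: "y \<in> layer u v (Suc i)"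
    obtain a where a: "adj y a" "dst u y = Suc (dst u a)"
      using dst_descent'[of u y] y Suc.prems by (auto simp: layer_def)
    then have "a \<in> layer u v i" using layer_closer[OF uv y Suc.prems] by (auto simp: closer_def)
    then show "y \<in> (\<Union>x\<in>layer u v i. S x)"
      using a y adj_sym by (auto simp: S_def layer_def)
  qed (auto simp: S_def intro: layer_farther[OF uv])
  moreover have "card (\<Union>x\<in>layer u v i. S x) = (\<Sum>x\<in>layer u v i. card (S x))"
  proof (rule card_UN_disjoint)
    show "\<forall>x\<in>layer u v i. \<forall>y\<in>layer u v i. x \<noteq> y \<longrightarrow> S x \<inter> S y = {}"
    proof (intro ballI impI equals0I)
      fix x y z assume xy: "x \<in> layer u v i" "y \<in> layer u v i" "x \<noteq> y" and z: "z \<in> S x \<inter> S y"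
      have "z \<in> layer u v (Suc i)" using z xy layer_farther[OF uv] by (auto simp: S_def)
      then show False
        using closer_unique'[of z x y u i] xy z Suc.prems adj_sym by (auto simp: S_def layer_def)
    qed
  qed auto
  moreover have "card (S x) = k - 1" if "x \<in> layer u v i" for x
    using card_farther[of v x] that Suc.prems by (auto simp: S_def layer_def)
  ultimately show ?case using Suc by simp
qed

text \<open>The two trees are disjoint and together have as many vertices as the Moore bound, so the
  excess is what remains.\<close>

lemma card_far:
  assumes uv: "adj u v"
  shows "card (far u v) = 4"
proof -
  have vu: "adj v u" using uv by (rule adj_sym)
  define T where "T a b = (\<Union>i<d. layer a b i)" for a b
  have cT: "card (T a b) = (\<Sum>i<d. (k - 1) ^ i)" if "adj a b" for a b
  proof -
    have "card (T a b) = (\<Sum>i<d. card (layer a b i))"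
      unfolding T_def by (rule card_UN_disjoint) (auto simp: layer_def)
    then show ?thesis using card_layer[OF that] by simp
  qed
  have near: "x \<in> T a b \<union> T b a" if "adj a b" "dst a x < d" for a b x
  proof -
    have "dst b x \<noteq> dst a x" using dst_adj_neq that by blast
    moreover have "dst b x \<le> Suc (dst a x)" "dst a x \<le> Suc (dst b x)"
      using dst_adj that adj_sym by blast+
    ultimately have "x \<in> layer a b (dst a x) \<or> x \<in> layer b a (dst b x) \<and> dst b x < d"
      using that by (auto simp: layer_def)
    then show ?thesis using that by (auto simp: T_def)
  qed
  have "UNIV = (T u v \<union> T v u) \<union> far u v"
    using near[OF uv] near[OF vu] by (force simp: far_def not_le)
  then have "CARD('v) = card ((T u v \<union> T v u) \<union> far u v)" by simp
  also have "\<dots> = card (T u v \<union> T v u) + card (far u v)"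
    by (rule card_Un_disjoint) (auto simp: T_def layer_def far_def)
  also have "card (T u v \<union> T v u) = card (T u v) + card (T v u)"
  proof (rule card_Un_disjoint)
    have "dst a x < dst b x" if "x \<in> T a b" for a b x
      using that by (auto simp: T_def layer_def)
    then show "T u v \<inter> T v u = {}" by (metis disjoint_iff less_asym)
  qed auto
  finally show ?thesis using order cT[OF uv] cT[OF vu] by simp
qed

text \<open>The first step \<open>a\<close> of a geodesic from \<open>x\<close> to \<open>u\<close>
  is matched with its last vertex \<open>f a\<close> before \<open>u\<close>. As \<open>f a\<close>
  is at distance \<open>d - 1\<close> from \<open>x\<close>, still below \<open>d\<close>, it
  determines \<open>a\<close>.\<close>

lemma card_closer_le:
  assumes "dst u x = d"
  shows "card (closer u x) \<le> card (closer x u)"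
proof -
  have "\<exists>w. adj u w \<and> dst w a = d - 2" if "a \<in> closer u x" for a
  proof -
    have "dst u a = d - 1" using that assms by (auto simp: closer_def)
    with dst_descent[of u a] d_ge obtain w where "adj u w" "dst u a = Suc (dst w a)" by auto
    then show ?thesis using \<open>dst u a = d - 1\<close> by (intro exI[of _ w]) auto
  qed
  then obtain f where f: "\<And>a. a \<in> closer u x \<Longrightarrow> adj u (f a) \<and> dst (f a) a = d - 2" by metis
  have fx: "dst x (f a) = d - 1" if a: "a \<in> closer u x" for a
  proof -
    have "dst x (f a) \<le> Suc (dst a (f a))" using a dst_adj[of x a "f a"] by (auto simp: closer_def)
    moreover have "dst u x \<le> Suc (dst (f a) x)" using f[OF a] dst_adj by blast
    ultimately show ?thesis using f[OF a] assms d_ge by (simp add: dst_sym)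
  qed
  show ?thesis
  proof (rule card_inj_on_le)
    show "f ` closer u x \<subseteq> closer x u"
      using f fx assms d_ge by (auto simp: closer_def dst_sym)
    show "inj_on f (closer u x)"
    proof (rule inj_onI)
      fix a b assume ab: "a \<in> closer u x" "b \<in> closer u x" "f a = f b"
      then show "a = b"
        using closer_unique[of x a b "f a" "d - 2"] f[OF ab(1)] f[OF ab(2)] fx[OF ab(1)] d_ge
        by (auto simp: closer_def dst_sym)
    qed
  qed simp
qed

lemma card_closer_sym: "dst u x = d \<Longrightarrow> card (closer u x) = card (closer x u)"
  using card_closer_le[of u x] card_closer_le[of x u] by (simp add: dst_sym)

text \<open>Both \<open>x\<close> and \<open>b\<close> are at distance \<open>d\<close> from
  \<open>u\<close>. The neighbours of \<open>u\<close> leading towards \<open>x\<close> and those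
  leading towards \<open>b\<close> are disjoint, so at most \<open>k - card (closer u x)\<close>
  neighbours of \<open>b\<close> are nearer to \<open>u\<close>. All its other neighbours are far
  from both ends.\<close>

lemma card_far_nbrs:
  assumes uv: "adj u v" and xu: "dst u x = d" and xv: "dst v x = d" and b: "b \<in> closer v x"
  shows "card (closer u x) \<le> card {y \<in> far u v. adj b y}"
proof -
  have xb: "adj x b" and bv: "dst v b = d - 1" using b xv by (auto simp: closer_def)
  have bu: "dst u b = d"
  proof -
    have "dst u b \<le> d" using dst_adj[OF uv, of b] bv d_ge by simp
    moreover have "d \<le> Suc (dst u b)" using dst_adj'[OF xb, of u] xu by simp
    moreover have "dst u b \<noteq> d - 1"
      using dst_adj_neq[of v u b] adj_sym[OF uv] bv d_ge by auto
    ultimately show ?thesis by simp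
  qed
  have disj: "closer x u \<inter> closer b u = {}"
  proof (rule equals0I)
    fix w assume "w \<in> closer x u \<inter> closer b u"
    then have "dst x w = d - 1" "dst b w = d - 1"
      using xu bu by (auto simp: closer_def dst_sym)
    then show False using dst_adj_neq[OF xb, of w] d_ge by auto
  qed
  have "card (closer x u) + card (closer b u) = card (closer x u \<union> closer b u)"
    using disj by (simp add: card_Un_disjoint)
  also have "\<dots> \<le> card {w. adj u w}"
    by (rule card_mono) (auto simp: closer_def)
  finally have "card (closer u x) + card (closer u b) \<le> k"
    by (simp add: degree card_closer_sym[OF xu] card_closer_sym[OF bu])
  moreover have "{y. adj b y} \<subseteq> closer u b \<union> {y \<in> far u v. adj b y}"
  proof
    fix y assume "y \<in> {y. adj b y}"
    then have by': "adj b y" by simp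
    show "y \<in> closer u b \<union> {y \<in> far u v. adj b y}"
    proof (cases "y \<in> closer u b")
      case False
      have "d \<le> Suc (dst u y)" using dst_adj'[OF by', of u] bu by simp
      with False by' bu have yu: "d \<le> dst u y" by (auto simp: closer_def)
      \<comment> \<open>This leaves \<open>d - 1\<close> as the only value below \<open>d\<close>
        for \<open>dst v y\<close>; it is excluded because the adjacent \<open>b\<close> already has
        it.\<close>
      have "dst u y \<le> Suc (dst v y)" using dst_adj[OF uv] .
      moreover have "dst v y \<noteq> d - 1" using dst_adj_neq'[OF by', of v] bv d_ge by simp
      ultimately show ?thesis using yu by' by (auto simp: far_def)
    qed simp
  qed
  then have "k \<le> card (closer u b \<union> {y \<in> far u v. adj b y})"
    unfolding degree[of b, symmetric] by (intro card_mono) auto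
  then have "k \<le> card (closer u b) + card {y \<in> far u v. adj b y}"
    using card_Un_le order_trans by blast
  ultimately show ?thesis by simp
qed

section \<open>Excluding vertices equidistant from the ends of an edge\<close>

lemma no_triangle: "\<lbrakk>adj x y; adj x z\<rbrakk> \<Longrightarrow> \<not> adj y z"
  using dst_of_adj[of x z] dst_of_adj[of y z] dst_adj_neq[of x y z] d_ge by linarith

text \<open>Since \<open>2 < d\<close>, vertices at distance 2 have a single common
  neighbour.\<close>

lemma no_quadrangle:
  assumes "adj x a" "adj x b" "adj y a" "adj y b" "x \<noteq> y"
  shows "a = b"
proof -
  have "dst a y = 1" "dst b y = 1" using dst_of_adj adj_sym assms d_ge by auto
  then have "dst x y \<le> 2" "dst x y \<noteq> 1" "dst x y \<noteq> 0"
    using dst_adj[OF assms(1), of y] dst_adj_neq[OF assms(1), of y] assms d_ge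
    by (auto simp: dst_eq_0)
  then show ?thesis
    using closer_unique[of x a b y 1] \<open>dst a y = 1\<close> \<open>dst b y = 1\<close> assms d_ge by auto
qed

lemma not_equidistant:
  assumes uv: "adj u v" and xu: "dst u x = d" and xv: "dst v x = d"
  shows False
proof -
  \<comment> \<open>These sets partition the neighbours of \<open>x\<close>; their sizes are
    \<open>p\<close>, \<open>q\<close>, \<open>r\<close> of the outline.\<close>
  define P Q R where "P = closer u x" and "Q = closer v x" and "R = {y \<in> far u v. adj x y}"
  \<comment> \<open>Removing \<open>x\<close>, which is adjacent to every \<open>c\<close> in
    \<open>P\<close> and \<open>Q\<close>, makes these sets disjoint and produces the terms
    \<open>q - 1\<close> and \<open>p - 1\<close>.\<close>
  define F where "F c = {y \<in> far u v. adj c y} - {x}" for c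
  have x: "x \<in> far u v" using xu xv by (simp add: far_def)
  have far_sym: "far u v = far v u" by (auto simp: far_def)
  have irrefl: "\<not> adj y y" for y using no_triangle[of y y y] by blast
  have F_card: "card (F c) = card {y \<in> far u v. adj c y} - 1" if "adj x c" for c
    unfolding F_def using that x adj_sym by (subst card_Diff_singleton) auto
  have FP: "card Q - 1 \<le> card (F c)" if "c \<in> P" for c
  proof -
    have "card Q \<le> card {y \<in> far v u. adj c y}"
      using card_far_nbrs[OF adj_sym[OF uv] xv xu] that by (simp add: P_def Q_def)
    then show ?thesis using F_card[of c] that far_sym by (simp add: P_def closer_def)
  qed
  have FQ: "card P - 1 \<le> card (F c)" if "c \<in> Q" for c
  proof -
    have "card P \<le> card {y \<in> far u v. adj c y}"
      using card_far_nbrs[OF uv xu xv] that by (simp add: P_def Q_def)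
    then show ?thesis using F_card[of c] that by (simp add: Q_def closer_def)
  qed
  have PQ: "P \<inter> Q = {}"
  proof (rule equals0I)
    fix c assume "c \<in> P \<inter> Q"
    then show False
      using dst_adj_neq[OF uv, of c] xu xv d_ge by (auto simp: P_def Q_def closer_def)
  qed
  have PR: "P \<inter> R = {}" and QR: "Q \<inter> R = {}"
    using xu xv by (auto simp: P_def Q_def R_def closer_def far_def)
  have adjx: "adj x c" if "c \<in> P \<union> Q" for c using that by (auto simp: P_def Q_def closer_def)
  have disj: "F a \<inter> F b = {}" if "a \<in> P \<union> Q" "b \<in> P \<union> Q" "a \<noteq> b" for a b
  proof (rule equals0I)
    fix y assume "y \<in> F a \<inter> F b"
    then have "adj y a" "adj y b" "x \<noteq> y" using adj_sym by (auto simp: F_def)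
    then show False using no_quadrangle[OF adjx adjx] that by blast
  qed
  have "{x} \<union> R \<union> (\<Union>c\<in>P \<union> Q. F c) \<subseteq> far u v"
    using x by (auto simp: R_def F_def)
  then have "card ({x} \<union> R \<union> (\<Union>c\<in>P \<union> Q. F c)) \<le> 4"
    using card_mono[of "far u v"] card_far[OF uv] by simp
  moreover have "card ({x} \<union> R \<union> (\<Union>c\<in>P \<union> Q. F c)) = card ({x} \<union> R) + card (\<Union>c\<in>P \<union> Q. F c)"
    using no_triangle adjx by (intro card_Un_disjoint) (auto simp: F_def R_def)
  moreover have "card ({x} \<union> R) = Suc (card R)"
    using irrefl by (simp add: R_def)
  moreover have "card (\<Union>c\<in>P \<union> Q. F c) = (\<Sum>c\<in>P. card (F c)) + (\<Sum>c\<in>Q. card (F c))"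
    using disj PQ by (subst card_UN_disjoint) (auto simp: sum.union_disjoint)
  moreover have "card P * (card Q - 1) \<le> (\<Sum>c\<in>P. card (F c))"
    using sum_bounded_below[of P "card Q - 1"] FP by simp
  moreover have "card Q * (card P - 1) \<le> (\<Sum>c\<in>Q. card (F c))"
    using sum_bounded_below[of Q "card P - 1"] FQ by simp
  ultimately have le: "Suc (card R) + card P * (card Q - 1) + card Q * (card P - 1) \<le> 4"
    by linarith
  have "{c. adj x c} = P \<union> Q \<union> R"
  proof (intro equalityI subsetI)
    fix c assume "c \<in> {c. adj x c}"
    then have "adj x c" by simp
    then show "c \<in> P \<union> Q \<union> R"
      using dst_adj'[of x c u] dst_adj'[of x c v] xu xv
      by (auto simp: P_def Q_def R_def closer_def far_def)
  qed (auto simp: P_def Q_def R_def closer_def)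
  then have "k = card (P \<union> Q \<union> R)" using degree[of x] by simp
  also have "\<dots> = card P + card Q + card R"
    using PQ PR QR by (simp add: card_Un_disjoint Int_Un_distrib2)
  finally have k: "k = card P + card Q + card R" .
  have "P \<noteq> {}"
    using dst_descent'[of u x] xu d_ge by (auto simp: P_def closer_def)
  then obtain p where "card P = Suc p" by (cases "card P") auto
  moreover have "Q \<noteq> {}"
    using dst_descent'[of v x] xv d_ge by (auto simp: Q_def closer_def)
  then obtain q where "card Q = Suc q" by (cases "card Q") auto
  \<comment> \<open>With \<open>p\<close> and \<open>q\<close> now one less than the cardinalities,
    \<open>le\<close> reads \<open>1 + card R + p + q + 2 * p * q \<le> 4\<close>, while
    \<open>6 \<le> k\<close> gives \<open>4 \<le> card R + p + q\<close>.\<close>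
  ultimately show False using le k k_ge by (simp add: algebra_simps)
qed

text \<open>Only four vertices are far, so one of the at least six neighbours of \<open>x\<close> is
  not; hence \<open>x\<close> is at distance exactly \<open>d\<close> from one end, and by
  \<open>not_equidistant\<close> not from the other.\<close>

lemma far_cases:
  assumes uv: "adj u v" and x: "x \<in> far u v"
  shows "dst u x = d \<and> dst v x = Suc d \<or> dst u x = Suc d \<and> dst v x = d"
proof -
  have "\<not> {y. adj x y} \<subseteq> far u v"
    using card_mono[of "far u v" "{y. adj x y}"] card_far[OF uv] degree[of x] k_ge by auto
  then obtain y where y: "adj x y" "dst u y < d \<or> dst v y < d"
    unfolding far_def by (auto simp: not_le) (metis not_le)+
  then have "dst u x = d \<or> dst v x = d"
    using dst_adj'[OF y(1), of u] dst_adj'[OF y(1), of v] x by (auto simp: far_def)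
  moreover have "dst u x \<le> Suc (dst v x)" "dst v x \<le> Suc (dst u x)"
    using dst_adj uv adj_sym by blast+
  ultimately show ?thesis
    using not_equidistant[OF uv] x by (force simp: far_def le_Suc_eq)
qed

text \<open>This is bipartiteness: the girth gives it near the edge, \<open>far_cases\<close>
  elsewhere.\<close>

lemma dst_adj_cases:
  assumes uv: "adj u v"
  shows "dst v x = Suc (dst u x) \<or> dst u x = Suc (dst v x)"
proof (cases "x \<in> far u v")
  case True
  then show ?thesis using far_cases[OF uv True] by auto
next
  case False
  then have "dst v x \<noteq> dst u x"
    using dst_adj_neq[OF uv, of x] dst_adj_neq[OF adj_sym[OF uv], of x]
    by (auto simp: far_def not_le)
  moreover have "dst u x \<le> Suc (dst v x)" "dst v x \<le> Suc (dst u x)"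
    using dst_adj uv adj_sym by blast+
  ultimately show ?thesis by auto
qed

lemma dst_le: "dst u x \<le> Suc d"
proof -
  have "{v. adj u v} \<noteq> {}" using degree[of u] k_ge by force
  then obtain v where uv: "adj u v" by blast
  show ?thesis
  proof (cases "x \<in> far u v")
    case True
    then show ?thesis using far_cases[OF uv True] by auto
  next
    case False
    then show ?thesis using dst_adj[OF uv, of x] by (auto simp: far_def not_le)
  qed
qed

end

section \<open>Distances in a graph\<close>

text \<open>Capping gives a natural number before the graph is known to be connected.\<close>

definition capped_dist :: "'v rel \<Rightarrow> nat \<Rightarrow> 'v \<Rightarrow> 'v \<Rightarrow> nat" where
  "capped_dist r N u x = (LEAST n. n = N \<or> (u, x) \<in> r ^^ n)"

lemma capped_dist_cases:
  "capped_dist r N u x = N \<or> (u, x) \<in> r ^^ capped_dist r N u x"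
  unfolding capped_dist_def by (rule LeastI[of _ N]) simp

lemma capped_dist_le_cap: "capped_dist r N u x \<le> N"
  unfolding capped_dist_def by (rule Least_le) simp

lemma capped_dist_le: "(u, x) \<in> r ^^ n \<Longrightarrow> capped_dist r N u x \<le> n"
  unfolding capped_dist_def by (rule Least_le) simp

lemma relpow_sym: "sym r \<Longrightarrow> (u, x) \<in> r ^^ n \<Longrightarrow> (x, u) \<in> r ^^ n"
proof (induction n arbitrary: x)
  case (Suc n)
  then obtain y where "(u, y) \<in> r ^^ n" "(y, x) \<in> r" by auto
  with Suc show ?case by (intro relpow_Suc_I2[of x y]) (auto dest: symD)
qed auto

lemma capped_dist_sym: "sym r \<Longrightarrow> capped_dist r N u x = capped_dist r N x u"
  unfolding capped_dist_def using relpow_sym[of r] by metis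

lemma capped_dist_eq_0:
  assumes "0 < N"
  shows "capped_dist r N u x = 0 \<longleftrightarrow> u = x"
  using capped_dist_cases[of r N u x] capped_dist_le[of u x 0 r N] assms by auto

lemma capped_dist_adj:
  assumes "(u, v) \<in> r"
  shows "capped_dist r N u x \<le> Suc (capped_dist r N v x)"
  using capped_dist_cases[of r N v x]
proof
  assume "capped_dist r N v x = N"
  then show ?thesis using capped_dist_le_cap[of r N u x] by simp
next
  assume "(v, x) \<in> r ^^ capped_dist r N v x"
  then show ?thesis by (rule capped_dist_le[OF relpow_Suc_I2[OF assms]])
qed

lemma capped_dist_descent:
  assumes "0 < capped_dist r N u x" "capped_dist r N u x < N"
  shows "\<exists>v. (u, v) \<in> r \<and> capped_dist r N u x = Suc (capped_dist r N v x)"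
proof -
  obtain n where n: "capped_dist r N u x = Suc n" using assms(1) gr0_implies_Suc by blast
  then have "(u, x) \<in> r ^^ Suc n" using capped_dist_cases[of r N u x] assms(2) by auto
  then obtain v where v: "(u, v) \<in> r" "(v, x) \<in> r ^^ n" by (rule relpow_Suc_E2)
  then have "capped_dist r N v x \<le> n" using capped_dist_le by metis
  then show ?thesis using v capped_dist_adj[OF v(1), of N x] n by (intro exI[of _ v]) auto
qed

section \<open>Walks, graph distance and girth\<close>

context wf_digraph
begin

lemma relpow_arcs_ends_awalk:
  assumes "u \<in> verts G"
  shows "(u, x) \<in> arcs_ends G ^^ n \<longleftrightarrow> (\<exists>p. awalk u p x \<and> length p = n)"
  using assms
proof (induction n arbitrary: u)
  case 0
  then show ?case by (auto simp: awalk_Nil_iff)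
next
  case (Suc n)
  show ?case
  proof
    assume "(u, x) \<in> arcs_ends G ^^ Suc n"
    then obtain v where "(u, v) \<in> arcs_ends G" "(v, x) \<in> arcs_ends G ^^ n"
      by (rule relpow_Suc_E2)
    then obtain e where e: "e \<in> arcs G" "tail G e = u" "head G e = v" by auto
    with \<open>(v, x) \<in> arcs_ends G ^^ n\<close> Suc.IH[of v] obtain p where "awalk v p x" "length p = n"
      by auto
    with e show "\<exists>p. awalk u p x \<and> length p = Suc n"
      by (intro exI[of _ "e # p"]) (auto simp: awalk_Cons_iff)
  next
    assume "\<exists>p. awalk u p x \<and> length p = Suc n"
    then obtain e p where "awalk u (e # p) x" "length p = n" by (metis length_Suc_conv)
    then have "e \<in> arcs G" "tail G e = u" "awalk (head G e) p x" by (auto simp: awalk_Cons_iff)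
    moreover from this have "(u, head G e) \<in> arcs_ends G" by (auto simp: arcs_ends_conv)
    ultimately show "(u, x) \<in> arcs_ends G ^^ Suc n"
      using Suc.IH[of "head G e"] \<open>length p = n\<close> by (intro relpow_Suc_I2[of u "head G e"]) auto
  qed
qed

text \<open>A value below the cap is realised by a walk, where the infimum of walk lengths defining
  \<open>graph_dist\<close> is attained.\<close>

lemma graph_dist_eq_capped_dist:
  assumes "u \<in> verts G" "capped_dist (arcs_ends G) N u x < N"
  shows "graph_dist G u x = ereal (real (capped_dist (arcs_ends G) N u x))"
proof -
  have cost: "awalk_cost (\<lambda>_. 1) p = real (length p)" for p
    by (induction p) auto
  obtain p where p: "awalk u p x" "length p = capped_dist (arcs_ends G) N u x"
    using capped_dist_cases[of "arcs_ends G" N u x] assms relpow_arcs_ends_awalk by auto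
  have "(INF p\<in>{p. awalk u p x}. ereal (real (length p))) = ereal (real (length p))"
  proof (rule INF_eqI)
    fix q assume "q \<in> {p. awalk u p x}"
    then show "ereal (real (length p)) \<le> ereal (real (length q))"
      using relpow_arcs_ends_awalk[OF assms(1), of x "length q"]
        capped_dist_le[of u x "length q" "arcs_ends G" N] p by auto
  next
    fix y assume "\<And>q. q \<in> {p. awalk u p x} \<Longrightarrow> y \<le> ereal (real (length q))"
    then show "y \<le> ereal (real (length p))" using p(1) by simp
  qed
  then show ?thesis by (simp add: graph_dist_def \<mu>_def cost p)
qed

lemma successively_imp_awalk:
  assumes "successively (dominates G) (x # xs)" "x \<in> verts G"
  shows "\<exists>p. awalk x p (last (x # xs)) \<and> awalk_verts x p = x # xs"
  using assms
proof (induction xs arbitrary: x)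
  case Nil
  then show ?case by (intro exI[of _ "[]"]) (auto simp: awalk_Nil_iff)
next
  case (Cons y ys)
  then obtain e where e: "e \<in> arcs G" "tail G e = x" "head G e = y" by auto
  moreover obtain p where "awalk y p (last (y # ys))" "awalk_verts y p = y # ys"
    using Cons.IH[of y] Cons.prems e by auto
  ultimately show ?case by (intro exI[of _ "e # p"]) (auto simp: awalk_Cons_iff)
qed

end

text \<open>If the head recurs in the distinct tail \<open>ys\<close>, the part in between is a
  cycle of length at most \<open>length ys\<close>, one less than the number of vertices listed and
  hence below the girth.\<close>

lemma (in graph) nonbacktracking_distinct:
  assumes nb: "nonbacktracking (dominates G) xs" and len: "enat (length xs) \<le> girth G"
  shows "distinct xs"
  using assms
proof (induction xs)
  case (Cons a ys)
  note nb = Cons.prems(1)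
  show ?case
  proof (cases "ys = []")
    case False
    then obtain b zs where ys: "ys = b # zs" by (cases ys) auto
    have "enat (length ys) < girth G"
      using Cons.prems(2) by (auto intro: order_less_le_trans[of _ "enat (Suc (length ys))"])
    then have dist: "distinct ys"
      using Cons.IH nb ys by (auto simp: nonbacktracking_Cons_Cons)
    have "a \<notin> set ys"
    proof
      assume "a \<in> set ys"
      then obtain us vs where split: "ys = us @ a # vs" by (meson split_list)
      define cs where "cs = us @ [a]"
      have suc: "successively (dominates G) (a # cs)"
        using nb split by (simp add: nonbacktracking_def cs_def successively_append_iff successively_Cons)
          (auto simp: hd_append split: if_splits)
      \<comment> \<open>Length 1 would be a loop and length 2 an immediate return;
        \<open>girth\<close> ranges over cycles of length at least 3 only.\<close>
      have "length cs \<ge> 3"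
      proof -
        have "us \<noteq> []" using suc adj_not_same by (auto simp: cs_def)
        moreover have "length us \<noteq> 1"
        proof
          assume "length us = 1"
          then obtain c where "us = [c]" by (auto simp: length_Suc_conv)
          then show False using nb split by (simp add: nonbacktracking_Cons_Cons)
        qed
        ultimately show ?thesis by (cases us) (auto simp: cs_def Suc_le_eq)
      qed
      have "(a, hd cs) \<in> arcs_ends G" using suc by (auto simp: successively_Cons cs_def)
      then have "a \<in> verts G" by (rule adj_in_verts)
      then obtain p where p: "awalk a p a" "awalk_verts a p = a # cs"
        using successively_imp_awalk[OF suc] by (auto simp: cs_def)
      then have "length p = length cs" using length_awalk_verts[of a p] by simp
      moreover have "distinct cs" using dist split by (simp add: cs_def)
      ultimately have "cycle p" "3 \<le> length p"
        using p \<open>length cs \<ge> 3\<close> by (auto simp: cycle_def intro!: exI[of _ a])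
      then have "girth G \<le> enat (length p)"
        unfolding girth_def by (intro INF_lower) auto
      also have "\<dots> \<le> enat (length ys)"
        using \<open>length p = length cs\<close> split by (simp add: cs_def)
      finally show False using \<open>enat (length ys) < girth G\<close> by simp
    qed
    then show ?thesis using dist by simp
  qed simp
qed simp

lemma (in nomulti_digraph) card_dominated: "card {v. u \<rightarrow> v} = out_degree G u"
proof -
  have "inj_on (head G) (out_arcs G u)"
    by (rule inj_onI) (auto intro: no_multi_arcs simp: arc_to_ends_def)
  moreover have "head G ` out_arcs G u = {v. u \<rightarrow> v}"
    by (auto simp: arcs_ends_conv)
  ultimately show ?thesis by (metis card_image out_degree_def)
qed

text \<open>With \<open>d < N\<close> every value up to \<open>d\<close> is a genuine distance, as
  descent requires.\<close>

lemma girth_distance_capped_dist: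
  fixes G :: "('v::finite, 'e) pre_digraph"
  assumes "graph G" "girth G = enat (2 * d)" "d < N"
  shows "girth_distance (dominates G) (capped_dist (arcs_ends G) N) d"
proof -
  interpret graph G by fact
  have sym: "sym (arcs_ends G)" using sym_arcs by (simp add: symmetric_def)
  show ?thesis
  proof
    show "v \<rightarrow>\<^bsub>G\<^esub> u" if "u \<rightarrow>\<^bsub>G\<^esub> v" for u v using sym that by (rule symD)
    show "distinct xs" if "nonbacktracking (dominates G) xs" "length xs \<le> 2 * d" for xs
      using nonbacktracking_distinct that assms by simp
    show "\<exists>v. u \<rightarrow>\<^bsub>G\<^esub> v \<and> capped_dist (arcs_ends G) N u x = Suc (capped_dist (arcs_ends G) N v x)"
      if "0 < capped_dist (arcs_ends G) N u x" "capped_dist (arcs_ends G) N u x \<le> d" for u x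
      using that \<open>d < N\<close> by (intro capped_dist_descent) auto
  qed (use \<open>d < N\<close> in \<open>auto simp: capped_dist_eq_0 intro: capped_dist_sym[OF sym] capped_dist_adj\<close>)
qed

section \<open>Polynomials of matrices\<close>

lemma linear_matrix_mult_right: "linear (\<lambda>B. A ** B :: real^'n::finite^'m::finite)"
  by (rule linearI) (simp_all add: matrix_add_ldistrib matrix_scalar_ac scalar_matrix_assoc)

lemma matrix_add_rdistrib: "(A + B) ** C = A ** C + B ** C"
  by (vector matrix_matrix_mult_def sum.distrib[symmetric] field_simps)

text \<open>Padding with zero coefficients gives polynomials of different degrees a common summation
  range, also when cancellation lowers a degree.\<close>

lemma matrix_poly_eq_sum:
  assumes "degree p \<le> N"
  shows "matrix_poly p A = (\<Sum>i\<le>N. coeff p i *\<^sub>R matrix_power A i)"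
  unfolding matrix_poly_def using assms
  by (intro sum.mono_neutral_left) (auto simp: coeff_eq_0)

lemma matrix_poly_diff: "matrix_poly (p - q) A = matrix_poly p A - matrix_poly q A"
  using degree_diff_le_max[of p q]
  by (simp add: matrix_poly_eq_sum[of _ "max (degree p) (degree q)"] algebra_simps sum_subtractf)

lemma matrix_poly_smult: "matrix_poly (smult c p) A = c *\<^sub>R matrix_poly p A"
  by (simp add: matrix_poly_eq_sum[of _ "degree p"] scaleR_sum_right)

lemma matrix_poly_1: "matrix_poly 1 A = mat 1"
  by (simp add: matrix_poly_def matrix_power_def)

lemma matrix_poly_X_mult: "matrix_poly ([:0, 1:] * p) A = A ** matrix_poly p A"
proof -
  have "matrix_poly ([:0, 1:] * p) A =
    (\<Sum>i\<le>Suc (degree p). coeff (pCons 0 p) i *\<^sub>R matrix_power A i)"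
    by (subst matrix_poly_eq_sum[of _ "Suc (degree p)"]) (auto simp: degree_pCons_le)
  also have "\<dots> = (\<Sum>i\<le>degree p. coeff p i *\<^sub>R (A ** matrix_power A i))"
    by (subst sum.atMost_Suc_shift) (simp add: matrix_power_def)
  also have "\<dots> = A ** matrix_poly p A"
    unfolding matrix_poly_def
    by (simp add: linear_sum[OF linear_matrix_mult_right] linear_scale[OF linear_matrix_mult_right])
  finally show ?thesis .
qed

lemma matrix_mult_indicator:
  "((\<chi> u v. if adj u v then 1 else 0) ** B :: real^'n::finite^'n) $ u $ x =
    (\<Sum>v | adj u v. B $ v $ x)"
proof -
  have "(\<Sum>v\<in>UNIV. (if adj u v then 1 else 0) * B $ v $ x) =
    (\<Sum>v\<in>UNIV. if adj u v then B $ v $ x else 0)"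
    by (rule sum.cong) auto
  also have "\<dots> = (\<Sum>v | adj u v. B $ v $ x)"
    by (simp add: sum.If_cases)
  finally show ?thesis by (simp add: matrix_matrix_mult_def)
qed

section \<open>The matrix identity\<close>

context excess_four
begin

lemma dst_eq_1: "dst u x = Suc 0 \<longleftrightarrow> adj u x"
  using dst_descent[of u x] dst_of_adj[of u x] d_ge by (auto simp: dst_eq_0)

lemma nbr_parity:
  assumes "adj u v"
  shows "even (dst v x) \<longleftrightarrow> odd (dst u x)"
  using dst_adj_cases[OF assms, of x] by auto

lemma sum_nbrs_indicator:
  "(\<Sum>v | adj u v. if Q v then 1 else 0 :: real) = real (card {v. adj u v \<and> Q v})"
  by (simp add: sum.If_cases Int_def)

text \<open>For \<open>i < d\<close> no cycle interferes, so \<open>H k i\<close> counts distances as in the \<open>k\<close>-regular tree.\<close>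

lemma dickson_entry:
  assumes "i < d"
  shows "matrix_poly (H k i) (\<chi> u v. if adj u v then 1 else 0) $ u $ x =
    (if dst u x \<le> i \<and> even (i + dst u x) then 1 else 0)"
  using assms
proof (induction i arbitrary: u x rule: induct_nat_012)
  case 0
  then show ?case by (auto simp: matrix_poly_1 mat_def dst_eq_0)
next
  case 1
  have "matrix_poly (H k (Suc 0)) A = A" for A :: "real^'v^'v"
    using matrix_poly_X_mult[of 1 A] by (simp add: matrix_poly_1)
  moreover have "dst u x \<le> Suc 0 \<and> odd (dst u x) \<longleftrightarrow> adj u x"
    using dst_eq_1[of u x] by (auto simp: le_Suc_eq)
  ultimately show ?case by simp
next
  case (ge2 i)
  define j where "j = dst u x"
  define S where "S = {v. adj u v \<and> dst v x \<le> Suc i \<and> even (Suc i + dst v x)}"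
  have entry: "matrix_poly (H k (Suc (Suc i))) (\<chi> u v. if adj u v then 1 else 0) $ u $ x =
    real (card S) - (real k - 1) * (if j \<le> i \<and> even (i + j) then 1 else 0)"
    using ge2 unfolding H.simps matrix_poly_diff matrix_poly_X_mult matrix_poly_smult
    by (simp add: matrix_mult_indicator sum_nbrs_indicator S_def j_def del: even_Suc)
  have S: "S = {v. adj u v \<and> dst v x \<le> Suc i \<and> even (i + j)}"
    using nbr_parity[of u _ x] by (auto simp: S_def j_def)
  \<comment> \<open>The value \<open>j = i + 1\<close> falls under the odd case.\<close>
  consider "odd (i + j)" | "even (i + j)" "j \<le> i" | "j = i + 2" | "even (i + j)" "i + 2 < j"
    by (cases "j = i + 1") force+
  then show ?case
  proof cases
    case 1
    then show ?thesis using entry S by (simp add: j_def)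
  next
    case 2
    \<comment> \<open>All \<open>k\<close> neighbours contribute and the recurrence subtracts
      \<open>k - 1\<close>, leaving 1.\<close>
    have "dst v x \<le> Suc i" if "adj u v" for v
      using dst_adj[OF adj_sym[OF that], of x] 2 by (simp add: j_def)
    then have "S = {v. adj u v}" using S 2 by auto
    then show ?thesis using entry 2 degree[of u] by (simp add: j_def)
  next
    case 3
    \<comment> \<open>On the new sphere only the neighbour of \<open>u\<close> nearer to
      \<open>x\<close> contributes; it is unique because \<open>i + 2 < d\<close>.\<close>
    have "dst v x \<le> Suc i \<longleftrightarrow> Suc (dst x v) = dst x u" if "adj u v" for v
      using dst_adj_cases[OF that, of x] 3 unfolding j_def dst_sym[of x] by linarith
    then have "S = closer x u" using S 3 by (auto simp: closer_def)
    moreover have "card (closer x u) = 1"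
      using card_closer[of x u] 3 ge2.prems by (simp add: j_def dst_sym[of x])
    ultimately show ?thesis using entry 3 by (simp add: j_def)
  next
    case 4
    have "\<not> dst v x \<le> Suc i" if "adj u v" for v
      using dst_adj[OF that, of x] 4 by (simp add: j_def)
    then have "S = {}" using S by auto
    then show ?thesis using entry 4 by (simp add: j_def)
  qed
qed

text \<open>Distances end at \<open>d + 1\<close>, the only value of the parity of
  \<open>d - 1\<close> that the polynomial misses; the excess matrix supplies it.\<close>

lemma dickson_plus_excess_entry:
  "(matrix_poly (H k (d - 1)) (\<chi> u v. if adj u v then 1 else 0) +
     (\<chi> u v. if dst u v = d + 1 then 1 else 0)) $ u $ x =
   (if even (d - 1 + dst u x) then 1 else 0)"
proof -
  consider "dst u x \<le> d - 1" | "dst u x = d" | "dst u x = d + 1"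
    using dst_le[of u x] by fastforce
  then show ?thesis
    using d_ge by cases (auto simp: dickson_entry)
qed

lemma dickson_identity:
  fixes A E :: "real^'v^'v"
  assumes A: "A = (\<chi> u v. if adj u v then 1 else 0)"
    and E: "E = (\<chi> u v. if dst u v = d + 1 then 1 else 0)"
  shows "real k *\<^sub>R all_ones_matrix = (A + real k *\<^sub>R mat 1) ** (matrix_poly (H k (d - 1)) A + E)"
proof -
  define B where "B = matrix_poly (H k (d - 1)) A + E"
  have B: "B $ u $ x = (if even (d - 1 + dst u x) then 1 else 0)" for u x
    unfolding B_def A E by (rule dickson_plus_excess_entry)
  \<comment> \<open>All neighbours of \<open>u\<close> have the same parity of distance to
    \<open>x\<close>, opposite to that of \<open>u\<close>, so the sum is \<open>k\<close> where
    \<open>B\<close> has 0 and 0 where \<open>B\<close> has 1.\<close>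
  have AB: "(A ** B) $ u $ x = real k - real k * B $ u $ x" for u x
  proof -
    have "(A ** B) $ u $ x = (\<Sum>v | adj u v. if odd (d - 1 + dst u x) then 1 else 0)"
      unfolding A matrix_mult_indicator using nbr_parity[of u _ x]
      by (intro sum.cong) (auto simp: B)
    then show ?thesis using degree[of u] by (simp add: B)
  qed
  have "(A + real k *\<^sub>R mat 1) ** B = A ** B + real k *\<^sub>R B"
    by (simp add: matrix_add_rdistrib flip: scalar_matrix_assoc)
  then show ?thesis
    unfolding B_def[symmetric] by (simp add: vec_eq_iff all_ones_matrix_def AB)
qed

end

lemma order_of_excess:
  assumes "excess k g G = 4" "g = 2 * d" "1 \<le> k"
  shows "card (verts G) = 2 * (\<Sum>i<d. (k - 1) ^ i) + 4"
proof -
  have "int (card (verts G)) = int (2 * (\<Sum>i<d. (k - 1) ^ i) + 4)"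
    using assms by (simp add: excess_def even_moore_bound_def of_nat_diff)
  then show ?thesis by (simp only: of_nat_eq_iff)
qed

theorem lemma2p3:
  fixes G :: "('v::finite, 'e) pre_digraph" and k g d :: nat
  assumes "k \<ge> 6" and "g = 2 * d" and "g \<ge> 6"
    and "verts G = UNIV"
    and "kg_graph k g G"
    and "excess k g G = 4"
  shows "real k *\<^sub>R all_ones_matrix =
    (adjacency_matrix G + real k *\<^sub>R mat 1) **
      (matrix_poly (H k (d - 1)) (adjacency_matrix G) + excess_matrix d G)"
proof -
  \<comment> \<open>The cap lies just above \<open>d + 1\<close>, so \<open>dst_le\<close> shows
    that it is never reached. Thus \<open>G\<close> is connected and \<open>?dst\<close> is the true
    distance.\<close>
  let ?dst = "capped_dist (arcs_ends G) (d + 2)"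
  interpret graph G using assms by (simp add: kg_graph_def)
  interpret excess_four "dominates G" ?dst d k
  proof (intro excess_four.intro excess_four_axioms.intro)
    show "girth_distance (dominates G) ?dst d"
      using assms by (intro girth_distance_capped_dist) (auto simp: kg_graph_def)
    show "card {v. u \<rightarrow>\<^bsub>G\<^esub> v} = k" for u
      using assms by (simp add: card_dominated kg_graph_def regular_def)
    show "CARD('v) = 2 * (\<Sum>i<d. (k - 1) ^ i) + 4"
      using order_of_excess[of k g G d] assms by simp
  qed (use assms in auto)
  have dist: "graph_dist G u x = ereal (real (?dst u x))" for u x
    using assms dst_le[of u x] by (intro graph_dist_eq_capped_dist) auto
  have "excess_matrix d G = (\<chi> u v. if ?dst u v = d + 1 then 1 else 0)"
    unfolding excess_matrix_def dist ereal.inject of_nat_eq_iff ..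
  then show ?thesis
    by (intro dickson_identity) (auto simp: adjacency_matrix_def)
qed

end
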